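(* Let $\chi:\mathbb{R}\to\mathbb{R}$ be a kernel which satisfies $m_0(\chi,u)=1$ and $m_1(\chi,u)=0$ for every $u\in\mathbb{R}$. Let $f\in C(\mathbb{R})$ and suppose that $$\|S^{\pi}_w f-f\|_\infty=o(w^{-1})\quad\text{as } w\to+\infty,$$ uniformly with respect to every sequence $\pi=(t_k)_{k\in\mathbb{Z}}\subset\mathbb{R}$ such that $\lim_{k\to\pm\infty}t_k=\pm\infty$ and $t_{k+1}-t_k=1$ for all $k\in\mathbb{Z}$; that is, for every $\varepsilon>0$ there is $w_0>0$ such that $w\,\|S^{\pi}_w f-f\|_\infty\le\varepsilon$ for all $w\ge w_0$ and all such sequences $\pi$. Here $$(S^{\pi}_w f)(x):=\sum_{k\in\mathbb{Z}}\left[w\int_{t_k/w}^{t_{k+1}/w}f(u)\,du\right]\chi(wx-t_k),\qquad x\in\mathbb{R},\ w>0.$$ Then $f$ is constant on $\mathbb{R}$.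
   Context: $C(\mathbb{R})$ denotes the space of all uniformly continuous and bounded functions $f:\mathbb{R}\to\mathbb{R}$, with the norm $\|f\|_\infty=\sup_{x\in\mathbb{R}}|f(x)|$. For $g:\mathbb{R}\to\mathbb{R}$, the discrete moment of order $\beta\in\{0,1,2,\dots\}$ at $u\in\mathbb{R}$ is $m_\beta(g,u):=\sum_{k\in\mathbb{Z}}g(u-k)(u-k)^\beta$, and the discrete absolute moment of order $\beta\ge 0$ is $M_\beta(g):=\sup_{u\in\mathbb{R}}\sum_{k\in\mathbb{Z}}|g(u-k)|\,|u-k|^\beta$. A condition prescribing the value of a discrete moment includes that the series defining it converges (absolutely). A kernel is a function $\chi:\mathbb{R}\to\mathbb{R}$ such that: (1) $\chi\in L^1(\mathbb{R})$ and $\chi$ is bounded in a neighbourhood of the origin; (2) $\sum_{k\in\mathbb{Z}}\chi(u-k)=1$ for every $u\in\mathbb{R}$; (3) there exists $\beta>0$ for which $M_\beta(\chi)<+\infty$. *)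

theory Defs
  imports "HOL-Analysis.Analysis"
begin

definition C_ub :: "(real \<Rightarrow> real) set" where
  "C_ub = {f. uniformly_continuous_on UNIV f \<and> bounded (range f)}"

text \<open>The supremum norm takes values in \<^typ>\<open>ennreal\<close>, so an unbounded function has norm
  \<open>\<infinity>\<close>; a supremum in \<^typ>\<open>real\<close> would be an unspecified number there.\<close>

definition sup_norm :: "(real \<Rightarrow> real) \<Rightarrow> ennreal" where
  "sup_norm f = (SUP x. ennreal \<bar>f x\<bar>)"

definition discrete_moment :: "nat \<Rightarrow> (real \<Rightarrow> real) \<Rightarrow> real \<Rightarrow> real" where
  "discrete_moment \<beta> g u = (\<Sum>\<^sub>\<infinity>k::int. g (u - of_int k) * (u - of_int k) ^ \<beta>)"

text \<open>The sum over the integers is unordered, and for real-valued families unordered summability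
  is absolute summability. The explicit summability requirement is needed because a divergent
  \<^const>\<open>infsum\<close> is \<open>0\<close> by convention.\<close>

definition has_discrete_moment :: "nat \<Rightarrow> (real \<Rightarrow> real) \<Rightarrow> real \<Rightarrow> real \<Rightarrow> bool" where
  "has_discrete_moment \<beta> g u m \<longleftrightarrow>
     (\<lambda>k::int. g (u - of_int k) * (u - of_int k) ^ \<beta>) summable_on UNIV \<and>
     discrete_moment \<beta> g u = m"

text \<open>The case distinction implements the convention \<open>0\<^sup>0 = 1\<close>, whereas \<open>0 powr 0 = 0\<close>.\<close>

definition discrete_abs_moment :: "real \<Rightarrow> (real \<Rightarrow> real) \<Rightarrow> ennreal" where
  "discrete_abs_moment \<beta> g =
     (SUP u. \<Sum>\<^sub>\<infinity>k::int. ennreal (\<bar>g (u - of_int k)\<bar> *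
        (if \<beta> = 0 then 1 else \<bar>u - of_int k\<bar> powr \<beta>)))"

definition sampling_kernel :: "(real \<Rightarrow> real) \<Rightarrow> bool" where
  "sampling_kernel chi \<longleftrightarrow>
     integrable lebesgue chi \<and>
     (\<exists>U. open U \<and> 0 \<in> U \<and> bounded (chi ` U)) \<and>
     (\<forall>u. ((\<lambda>k::int. chi (u - of_int k)) has_sum 1) UNIV) \<and>
     (\<exists>\<beta>>0. discrete_abs_moment \<beta> chi < \<infinity>)"

definition unit_step_seq :: "(int \<Rightarrow> real) \<Rightarrow> bool" where
  "unit_step_seq t \<longleftrightarrow>
     filterlim t at_top at_top \<and> filterlim t at_bot at_bot \<and> (\<forall>k. t (k + 1) - t k = 1)"

text \<open>The sampling Kantorovich operator \<open>S\<^sup>\<pi>\<^sub>w\<close> with kernel \<open>chi\<close> and \<open>\<pi> = (t\<^sub>k)\<close>.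
  For an increasing \<open>t\<close>, a kernel and \<open>f \<in> C_ub\<close> the cell integrals exist;
  for unit steps the series converges absolutely.\<close>

definition kantorovich ::
  "(real \<Rightarrow> real) \<Rightarrow> (int \<Rightarrow> real) \<Rightarrow> real \<Rightarrow> (real \<Rightarrow> real) \<Rightarrow> real \<Rightarrow> real" where
  "kantorovich chi t w f x =
     (\<Sum>\<^sub>\<infinity>k::int. (w * integral {t k / w .. t (k + 1) / w} f) * chi (w * x - t k))"

end

(* Fix x and take the nodes t_k = w x + k: the kernel is then only sampled at the integers -k, and
   with h = 1/w the operator at x is the average, with weights a_k = chi(-k), of the means of f over
   the cells [x + k h, x + (k + 1) h].  Here the a_k sum to 1, have first moment 0 and a finite
   absolute first moment.  Integrating over x in [alpha, beta] replaces f by a function Psi with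
   Psi''(0) = f(beta) - f(alpha); by dominated convergence the error of the average, divided by h,
   then tends to the sum of a_k (k + 1/2) Psi''(0), which is (f(beta) - f(alpha)) / 2, the 1/2 being
   the offset of the centre of a cell.  By hypothesis that limit is 0. *)
theory Submission
  imports Defs
begin

section \<open>Antiderivatives and interchange of limits with unordered sums\<close>

lemma continuous_real_antiderivative:
  fixes f :: "real \<Rightarrow> real"
  assumes "continuous_on UNIV f"
  obtains F where "\<And>x. (F has_real_derivative f x) (at x)"
proof -
  have "isCont f x" for x
    using assms by (simp add: continuous_on_eq_continuous_at)
  then have "\<exists>F. \<forall>x :: real. - \<infinity> < ereal x \<longrightarrow> ereal x < \<infinity> \<longrightarrow> (F has_vector_derivative f x) (at x)"
    by (intro einterval_antiderivative) auto
  then show ?thesis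
    using that by (auto simp: has_real_derivative_iff_has_vector_derivative)
qed

text \<open>By the Weierstrass M-test the finite partial sums converge uniformly over all indices at
  which the domination holds, so the limit along \<open>G\<close> and the limit over finite sets may
  be exchanged.\<close>

lemma tendsto_infsum_dominated:
  fixes a :: "'a \<Rightarrow> 'b \<Rightarrow> 'c :: banach"
  assumes lim: "\<And>k. k \<in> X \<Longrightarrow> (a k \<longlongrightarrow> b k) G"
    and bound: "\<forall>\<^sub>F n in G. \<forall>k\<in>X. norm (a k n) \<le> M k"
    and M: "M summable_on X"
    and G: "G \<noteq> bot"
  shows "((\<lambda>n. \<Sum>\<^sub>\<infinity>k\<in>X. a k n) \<longlongrightarrow> (\<Sum>\<^sub>\<infinity>k\<in>X. b k)) G"
proof (rule swap_uniform_limit')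
  define S where "S = {n. \<forall>k\<in>X. norm (a k n) \<le> M k}"
  show "uniform_limit S (\<lambda>K n. \<Sum>k\<in>K. a k n) (\<lambda>n. \<Sum>\<^sub>\<infinity>k\<in>X. a k n) (finite_subsets_at_top X)"
    by (rule Weierstrass_m_test_general[OF _ M]) (auto simp: S_def)
  show "\<forall>\<^sub>F n in G. n \<in> S"
    using bound by (simp add: S_def)
  show "\<forall>\<^sub>F K in finite_subsets_at_top X. ((\<lambda>n. \<Sum>k\<in>K. a k n) \<longlongrightarrow> (\<Sum>k\<in>K. b k)) G"
    using lim by (intro eventually_finite_subsets_at_top_weakI tendsto_sum) auto
  \<comment> \<open>The domination survives the limit, so \<open>b\<close> is summable; otherwise
    its \<open>infsum\<close> would be the default 0 rather than the limit of its partial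
    sums.\<close>
  have "norm (b k) \<le> M k" if "k \<in> X" for k
  proof (rule tendsto_upperbound[OF tendsto_norm[OF lim[OF that]] _ G])
    show "\<forall>\<^sub>F n in G. norm (a k n) \<le> M k"
      using bound by eventually_elim (use that in auto)
  qed
  then have "(\<lambda>k. norm (b k)) summable_on X"
    by (intro summable_on_comparison_test[OF M]) auto
  then have "b summable_on X"
    by (rule abs_summable_summable)
  then show "(sum b \<longlongrightarrow> (\<Sum>\<^sub>\<infinity>k\<in>X. b k)) (finite_subsets_at_top X)"
    using has_sum_infsum unfolding has_sum_def by blast
qed auto

text \<open>The M-test gives uniform convergence on the compact interval, and integration commutes
  with uniform limits of continuous functions.\<close>

lemma has_integral_infsum:
  fixes f :: "'a \<Rightarrow> real \<Rightarrow> 'b :: banach"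
  assumes int: "\<And>k. k \<in> X \<Longrightarrow> (f k has_integral I k) {a..b}"
    and cont: "\<And>k. k \<in> X \<Longrightarrow> continuous_on {a..b} (f k)"
    and bound: "\<And>k x. k \<in> X \<Longrightarrow> x \<in> {a..b} \<Longrightarrow> norm (f k x) \<le> M k"
    and M: "M summable_on X"
  shows "((\<lambda>x. \<Sum>\<^sub>\<infinity>k\<in>X. f k x) has_integral (\<Sum>\<^sub>\<infinity>k\<in>X. I k)) {a..b}"
proof -
  \<comment> \<open>Intersecting with \<open>X\<close> makes every partial sum continuous, even for finite sets not inside \<open>X\<close>.\<close>
  have ul: "uniform_limit {a..b} (\<lambda>K x. \<Sum>k\<in>K \<inter> X. f k x) (\<lambda>x. \<Sum>\<^sub>\<infinity>k\<in>X. f k x)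
      (finite_subsets_at_top X)"
  proof (subst uniform_limit_cong)
    show "uniform_limit {a..b} (\<lambda>K x. \<Sum>k\<in>K. f k x) (\<lambda>x. \<Sum>\<^sub>\<infinity>k\<in>X. f k x)
        (finite_subsets_at_top X)"
      by (rule Weierstrass_m_test_general[OF _ M]) (use bound in auto)
    show "\<forall>\<^sub>F K in finite_subsets_at_top X. \<forall>x\<in>{a..b}. (\<Sum>k\<in>K \<inter> X. f k x) = (\<Sum>k\<in>K. f k x)"
      by (intro eventually_finite_subsets_at_top_weakI) (auto simp: Int_absorb2)
  qed auto
  obtain J L where J: "\<And>K. ((\<lambda>x. \<Sum>k\<in>K \<inter> X. f k x) has_integral J K) {a..b}"
    and L: "((\<lambda>x. \<Sum>\<^sub>\<infinity>k\<in>X. f k x) has_integral L) {a..b}"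
    and JL: "(J \<longlongrightarrow> L) (finite_subsets_at_top X)"
    using uniform_limit_integral[OF ul] cont by (auto intro!: continuous_on_sum)
  \<comment> \<open>The limit theorem only provides some integrals \<open>J\<close> converging to
    some \<open>L\<close>. Identifying \<open>J\<close> with the partial sums of \<open>I\<close>
    yields both the summability of \<open>I\<close> and the value of its sum.\<close>
  have "J K = (\<Sum>k\<in>K. I k)" if "finite K" "K \<subseteq> X" for K
    using that J[of K] int
    by (intro has_integral_unique[OF J])
       (auto simp: Int_absorb2 intro!: has_integral_sum)
  then have "\<forall>\<^sub>F K in finite_subsets_at_top X. J K = sum I K"
    by (intro eventually_finite_subsets_at_top_weakI) auto
  with JL have "(sum I \<longlongrightarrow> L) (finite_subsets_at_top X)"
    by (simp add: tendsto_cong)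
  then have "(I has_sum L) X"
    by (simp add: has_sum_def)
  with L show ?thesis
    by (simp add: infsumI)
qed

section \<open>Second-order behaviour of an increment over one cell\<close>

text \<open>The quadratic Taylor term contributes \<open>q / 2\<close> times (c + 1)^2 - c^2 = 2 c +
  1. Since \<open>g\<close> is only assumed differentiable at 0, L'Hopital is applied once and the
  rest is a difference quotient at 0.\<close>

lemma cell_increment_tendsto:
  fixes \<Psi> g :: "real \<Rightarrow> real"
  assumes \<Psi>: "\<And>y. (\<Psi> has_real_derivative g y) (at y)"
    and g: "(g has_real_derivative q) (at 0)"
  shows "((\<lambda>h. (\<Psi> ((c + 1) * h) - \<Psi> (c * h) - h * g 0) / h\<^sup>2) \<longlongrightarrow> (c + 1 / 2) * q) (at_right 0)"
proof (rule lhopital_right_0)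
  have cont: "isCont \<Psi> y" for y
    using \<Psi> by (rule DERIV_isCont)
  have "((\<lambda>h. \<Psi> ((c + 1) * h) - \<Psi> (c * h) - h * g 0) \<longlongrightarrow>
      \<Psi> ((c + 1) * 0) - \<Psi> (c * 0) - 0 * g 0) (at_right 0)"
    by (intro tendsto_intros isCont_tendsto_compose[OF cont])
  then show "((\<lambda>h. \<Psi> ((c + 1) * h) - \<Psi> (c * h) - h * g 0) \<longlongrightarrow> 0) (at_right 0)"
    by simp
  have "((\<lambda>h::real. h\<^sup>2) \<longlongrightarrow> 0\<^sup>2) (at_right 0)"
    by (intro tendsto_intros)
  then show "((\<lambda>h::real. h\<^sup>2) \<longlongrightarrow> 0) (at_right 0)"
    by simp
  show "\<forall>\<^sub>F h in at_right 0. ((\<lambda>h. \<Psi> ((c + 1) * h) - \<Psi> (c * h) - h * g 0) has_real_derivative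
      (c + 1) * g ((c + 1) * h) - c * g (c * h) - g 0) (at h)"
    by (intro always_eventually allI) (auto intro!: derivative_eq_intros DERIV_chain2[OF \<Psi>])
  show "\<forall>\<^sub>F h in at_right 0. ((\<lambda>h::real. h\<^sup>2) has_real_derivative 2 * h) (at h)"
    by (intro always_eventually allI) (auto intro!: derivative_eq_intros)
  show "\<forall>\<^sub>F h in at_right 0. (h::real)\<^sup>2 \<noteq> 0" "\<forall>\<^sub>F h in at_right 0. 2 * (h::real) \<noteq> 0"
    by (auto simp: eventually_at_filter)
  \<comment> \<open>The function \<open>(c + 1) * g ((c + 1) * h) - c * g (c * h)\<close> equals
    \<open>g 0\<close> at \<open>h = 0\<close>, so the quotient of derivatives is half its
    difference quotient at 0.\<close>
  have "((\<lambda>h. g (d * h)) has_real_derivative q * d) (at 0)" for d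
    by (rule DERIV_chain2[where f = g]) (use g in \<open>auto intro!: derivative_eq_intros\<close>)
  then have "((\<lambda>h. (c + 1) * g ((c + 1) * h) - c * g (c * h)) has_real_derivative
      (c + 1) * (q * (c + 1)) - c * (q * c)) (at 0)"
    by (intro DERIV_diff DERIV_cmult)
  then have "((\<lambda>h. ((c + 1) * g ((c + 1) * h) - c * g (c * h) - g 0) / h) \<longlongrightarrow>
      (c + 1) * (q * (c + 1)) - c * (q * c)) (at 0)"
    by (simp add: DERIV_def algebra_simps)
  then have "((\<lambda>h. ((c + 1) * g ((c + 1) * h) - c * g (c * h) - g 0) / h / 2) \<longlongrightarrow>
      ((c + 1) * (q * (c + 1)) - c * (q * c)) / 2) (at_right 0)"
    by (intro tendsto_intros) (auto intro: tendsto_mono at_le)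
  moreover have "((c + 1) * (q * (c + 1)) - c * (q * c)) / 2 = (c + 1 / 2) * q"
    by (simp add: field_simps)
  ultimately show "((\<lambda>h. ((c + 1) * g ((c + 1) * h) - c * g (c * h) - g 0) / (2 * h)) \<longlongrightarrow>
      (c + 1 / 2) * q) (at_right 0)"
    by (simp add: field_simps)
qed

text \<open>By the mean value theorem the increment is \<open>h * g z\<close> with \<open>z\<close>
  in the cell, hence within \<open>(\<bar>c\<bar> + 1) * h\<close> of 0. The growth is linear in
  \<open>c\<close>, so a finite absolute first moment of the weights makes these bounds
  summable.\<close>

lemma cell_increment_bound:
  fixes \<Psi> g :: "real \<Rightarrow> real"
  assumes \<Psi>: "\<And>y. (\<Psi> has_real_derivative g y) (at y)"
    and g: "\<And>y. \<bar>g y - g 0\<bar> \<le> L * \<bar>y\<bar>"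
    and h: "h > 0"
  shows "\<bar>\<Psi> ((c + 1) * h) - \<Psi> (c * h) - h * g 0\<bar> \<le> L * (\<bar>c\<bar> + 1) * h\<^sup>2"
proof -
  have "c * h < (c + 1) * h"
    using h by simp
  then obtain z where z: "c * h < z" "z < (c + 1) * h"
      "\<Psi> ((c + 1) * h) - \<Psi> (c * h) = ((c + 1) * h - c * h) * g z"
    using MVT2[of "c * h" "(c + 1) * h" \<Psi> g] \<Psi> by blast
  have L: "L \<ge> 0"
    using g[of 1] by simp
  have "\<bar>z\<bar> \<le> max \<bar>c * h\<bar> \<bar>(c + 1) * h\<bar>"
    using z by auto
  also have "\<dots> \<le> (\<bar>c\<bar> + 1) * h"
    using h by (auto simp: abs_mult intro!: mult_right_mono)
  finally have "L * \<bar>z\<bar> \<le> L * ((\<bar>c\<bar> + 1) * h)"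
    by (rule mult_left_mono) (rule L)
  with g[of z] have gz: "\<bar>g z - g 0\<bar> \<le> L * ((\<bar>c\<bar> + 1) * h)"
    by linarith
  have "\<Psi> ((c + 1) * h) - \<Psi> (c * h) - h * g 0 = h * (g z - g 0)"
    using z(3) by (simp add: algebra_simps)
  then have "\<bar>\<Psi> ((c + 1) * h) - \<Psi> (c * h) - h * g 0\<bar> = h * \<bar>g z - g 0\<bar>"
    using h by (simp add: abs_mult)
  also have "\<dots> \<le> h * (L * ((\<bar>c\<bar> + 1) * h))"
    using gz h by (intro mult_left_mono) auto
  finally show ?thesis
    by (simp add: power2_eq_square mult_ac)
qed

section \<open>Saturation for averages of cell means with fixed weights\<close>

text \<open>As \<open>f\<close> is merely continuous, its cell means have no first-order expansion
  at a point; integrating the error in \<open>x\<close> over [\<alpha>, \<beta>] supplies the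
  missing derivative.\<close>

lemma saturation_discrete_average:
  fixes a :: "int \<Rightarrow> real" and f F :: "real \<Rightarrow> real"
  assumes a0: "(a has_sum 1) UNIV"
    and a1: "((\<lambda>k. of_int k * a k) has_sum 0) UNIV"
    and F: "\<And>x. (F has_real_derivative f x) (at x)"
    and f: "continuous_on UNIV f"
    and B: "\<And>x. \<bar>f x\<bar> \<le> B"
    and approx: "\<And>\<epsilon>. \<epsilon> > 0 \<Longrightarrow> \<forall>\<^sub>F h in at_right 0. \<forall>x.
      \<bar>(\<Sum>\<^sub>\<infinity>k. a k * ((F (x + (of_int k + 1) * h) - F (x + of_int k * h)) / h)) - f x\<bar> \<le> \<epsilon> * h"
    and less: "\<alpha> < \<beta>"
  shows "f \<alpha> = f \<beta>"
proof -
  have contF: "continuous_on UNIV F"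
    by (meson F DERIV_isCont continuous_at_imp_continuous_on)
  obtain \<Phi> where \<Phi>: "\<And>x. (\<Phi> has_real_derivative F x) (at x)"
    using continuous_real_antiderivative[OF contF] by blast
  \<comment> \<open>\<open>\<Psi> d\<close> is the integral of \<open>F (x + d)\<close> over x in
    [\<alpha>, \<beta>]; \<open>g\<close> is its derivative and \<open>q\<close> its second
    derivative at 0. In \<open>r\<close>, the subtracted term \<open>h * g 0\<close> accounts for
    the integral of \<open>f\<close> itself.\<close>
  define \<Psi> where "\<Psi> y = \<Phi> (\<beta> + y) - \<Phi> (\<alpha> + y)" for y
  define g where "g y = F (\<beta> + y) - F (\<alpha> + y)" for y
  define q where "q = f \<beta> - f \<alpha>"
  define r where "r k h = (\<Psi> ((of_int k + 1) * h) - \<Psi> (of_int k * h) - h * g 0) / h\<^sup>2" for k :: int and h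
  define S where "S h x = (\<Sum>\<^sub>\<infinity>k. a k * ((F (x + (of_int k + 1) * h) - F (x + of_int k * h)) / h))" for h x
  have \<Psi>: "(\<Psi> has_real_derivative g y) (at y)" for y
    unfolding \<Psi>_def g_def
    by (auto intro!: derivative_eq_intros DERIV_chain2[OF \<Phi>])
  have g': "(g has_real_derivative f (\<beta> + y) - f (\<alpha> + y)) (at y)" for y
    unfolding g_def by (auto intro!: derivative_eq_intros DERIV_chain2[OF F])
  have gL: "\<bar>g y - g 0\<bar> \<le> 2 * B * \<bar>y\<bar>" for y
  proof -
    have "\<bar>f (\<beta> + y) - f (\<alpha> + y)\<bar> \<le> 2 * B" for y
      using B[of "\<beta> + y"] B[of "\<alpha> + y"] by linarith
    then show ?thesis
      using field_differentiable_bound[of UNIV g "\<lambda>y. f (\<beta> + y) - f (\<alpha> + y)" "2 * B" y 0] g'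
      by simp
  qed
  \<comment> \<open>For real families unordered summability is absolute, so the two moment
    conditions already give the absolute moments that build the dominating series.\<close>
  have abs0: "(\<lambda>k. \<bar>a k\<bar>) summable_on UNIV"
    using a0 summable_on_iff_abs_summable_on_real[of a] by (auto simp: summable_on_def)
  have abs1: "(\<lambda>k. \<bar>of_int k * a k\<bar>) summable_on UNIV"
    using a1 summable_on_iff_abs_summable_on_real[of "\<lambda>k. of_int k * a k"]
    by (auto simp: summable_on_def)
  have M: "(\<lambda>k. 2 * B * (\<bar>of_int k * a k\<bar> + \<bar>a k\<bar>)) summable_on UNIV"
    by (intro summable_on_cmult_right summable_on_add abs0 abs1)
  have rbound: "\<bar>a k * r k h\<bar> \<le> 2 * B * (\<bar>of_int k * a k\<bar> + \<bar>a k\<bar>)" if "h > 0" for k h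
  proof -
    have "\<bar>r k h\<bar> \<le> 2 * B * (\<bar>of_int k\<bar> + 1)"
      using cell_increment_bound[OF \<Psi> gL that, of "of_int k"] that
      by (simp add: r_def pos_divide_le_eq)
    then have "\<bar>a k\<bar> * \<bar>r k h\<bar> \<le> \<bar>a k\<bar> * (2 * B * (\<bar>of_int k\<bar> + 1))"
      by (rule mult_left_mono) simp
    then show ?thesis
      by (simp add: abs_mult algebra_simps)
  qed
  have "((\<lambda>h. \<Sum>\<^sub>\<infinity>k. a k * r k h) \<longlongrightarrow> (\<Sum>\<^sub>\<infinity>k. a k * ((of_int k + 1 / 2) * q))) (at_right 0)"
  proof (rule tendsto_infsum_dominated[OF _ _ M])
    fix k :: int
    have "(g has_real_derivative q) (at 0)"
      using g'[of 0] by (simp add: q_def)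
    then show "((\<lambda>h. a k * r k h) \<longlongrightarrow> a k * ((of_int k + 1 / 2) * q)) (at_right 0)"
      unfolding r_def by (intro tendsto_intros cell_increment_tendsto \<Psi>)
    show "\<forall>\<^sub>F h in at_right 0. \<forall>k\<in>UNIV. norm (a k * r k h) \<le> 2 * B * (\<bar>of_int k * a k\<bar> + \<bar>a k\<bar>)"
      using eventually_at_right_less[of 0] by eventually_elim (use rbound in simp)
  qed auto
  also have "(\<Sum>\<^sub>\<infinity>k. a k * ((of_int k + 1 / 2) * q)) = q / 2"
  proof (rule infsumI)
    have "((\<lambda>k. q * (of_int k * a k) + q / 2 * a k) has_sum q * 0 + q / 2 * 1) UNIV"
      by (intro has_sum_add has_sum_cmult_right a0 a1)
    then show "((\<lambda>k. a k * ((of_int k + 1 / 2) * q)) has_sum q / 2) UNIV"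
      by (simp add: algebra_simps)
  qed
  finally have lim: "((\<lambda>h. \<Sum>\<^sub>\<infinity>k. a k * r k h) \<longlongrightarrow> q / 2) (at_right 0)" .

  \<comment> \<open>An exact identity: the integrated k-th cell mean is
    \<open>D k = g 0 + h * r k h\<close>, and because the weights sum to 1 the terms
    \<open>g 0\<close> add up to the integral of \<open>f\<close> and cancel.\<close>
  have remainder: "((\<lambda>x. S h x - f x) has_integral h * (\<Sum>\<^sub>\<infinity>k. a k * r k h)) {\<alpha>..\<beta>}" if h: "h > 0" for h
  proof -
    define D where "D k = (\<Psi> ((of_int k + 1) * h) - \<Psi> (of_int k * h)) / h" for k :: int
    have "(S h has_integral (\<Sum>\<^sub>\<infinity>k. a k * D k)) {\<alpha>..\<beta>}"
      unfolding S_def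
    proof (rule has_integral_infsum)
      fix k :: int
      have "((\<lambda>x. F (x + d)) has_integral \<Psi> d) {\<alpha>..\<beta>}" for d
      proof -
        have "((\<lambda>x. \<Phi> (x + d)) has_real_derivative F (x + d)) (at x)" for x
          using \<Phi>[of "x + d"] by (simp add: DERIV_shift)
        then have "((\<lambda>x. F (x + d)) has_integral \<Phi> (\<beta> + d) - \<Phi> (\<alpha> + d)) {\<alpha>..\<beta>}"
          using less
          by (intro fundamental_theorem_of_calculus)
             (auto simp flip: has_real_derivative_iff_has_vector_derivative
               intro: has_field_derivative_at_within)
        then show ?thesis
          by (simp add: \<Psi>_def)
      qed
      then show "((\<lambda>x. a k * ((F (x + (of_int k + 1) * h) - F (x + of_int k * h)) / h))
          has_integral a k * D k) {\<alpha>..\<beta>}"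
        unfolding D_def by (intro has_integral_mult_right has_integral_divide has_integral_diff)
      have "continuous_on {\<alpha>..\<beta>} (\<lambda>x. F (x + d))" for d
        by (rule continuous_on_compose2[OF contF]) (auto intro!: continuous_intros)
      then show "continuous_on {\<alpha>..\<beta>}
          (\<lambda>x. a k * ((F (x + (of_int k + 1) * h) - F (x + of_int k * h)) / h))"
        using h by (intro continuous_intros) auto
    next
      fix k :: int and x :: real
      \<comment> \<open>\<open>F\<close> is \<open>B\<close>-Lipschitz, so every cell mean is
        bounded by \<open>B\<close> uniformly in \<open>x\<close>, which justifies termwise
        integration.\<close>
      have "\<bar>F (x + (of_int k + 1) * h) - F (x + of_int k * h)\<bar> \<le> B * h"
        using field_differentiable_bound[of UNIV F f B "x + (of_int k + 1) * h" "x + of_int k * h"] F B h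
        by (simp add: algebra_simps)
      then have "\<bar>(F (x + (of_int k + 1) * h) - F (x + of_int k * h)) / h\<bar> \<le> B"
        using h by (simp add: pos_divide_le_eq)
      then have "\<bar>a k\<bar> * \<bar>(F (x + (of_int k + 1) * h) - F (x + of_int k * h)) / h\<bar> \<le> \<bar>a k\<bar> * B"
        by (rule mult_left_mono) simp
      then show "norm (a k * ((F (x + (of_int k + 1) * h) - F (x + of_int k * h)) / h)) \<le> \<bar>a k\<bar> * B"
        by (simp only: real_norm_def abs_mult)
    next
      show "(\<lambda>k. \<bar>a k\<bar> * B) summable_on UNIV"
        by (intro summable_on_cmult_left abs0)
    qed
    moreover have "(f has_integral g 0) {\<alpha>..\<beta>}"
    proof -
      have "(f has_integral F \<beta> - F \<alpha>) {\<alpha>..\<beta>}"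
        using less F
        by (intro fundamental_theorem_of_calculus)
           (auto simp flip: has_real_derivative_iff_has_vector_derivative
             intro: has_field_derivative_at_within)
      then show ?thesis
        by (simp add: g_def)
    qed
    ultimately have "((\<lambda>x. S h x - f x) has_integral (\<Sum>\<^sub>\<infinity>k. a k * D k) - g 0) {\<alpha>..\<beta>}"
      by (rule has_integral_diff)
    moreover have "(\<Sum>\<^sub>\<infinity>k. a k * D k) = h * (\<Sum>\<^sub>\<infinity>k. a k * r k h) + g 0"
    proof (rule infsumI)
      have "(\<lambda>k. norm (a k * r k h)) summable_on UNIV"
        by (rule summable_on_comparison_test[OF M]) (use rbound h in simp_all)
      then have "((\<lambda>k. a k * r k h) has_sum (\<Sum>\<^sub>\<infinity>k. a k * r k h)) UNIV"
        by (rule has_sum_infsum[OF abs_summable_summable])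
      then have "((\<lambda>k. h * (a k * r k h) + g 0 * a k) has_sum h * (\<Sum>\<^sub>\<infinity>k. a k * r k h) + g 0 * 1) UNIV"
        by (intro has_sum_add has_sum_cmult_right a0)
      moreover have "h * (a k * r k h) + g 0 * a k = a k * D k" for k
        using h by (simp add: r_def D_def field_simps power2_eq_square)
      ultimately show "((\<lambda>k. a k * D k) has_sum h * (\<Sum>\<^sub>\<infinity>k. a k * r k h) + g 0) UNIV"
        by simp
    qed
    ultimately show ?thesis
      by simp
  qed

  have "((\<lambda>h. \<Sum>\<^sub>\<infinity>k. a k * r k h) \<longlongrightarrow> 0) (at_right 0)"
  proof (rule tendstoI)
    fix e :: real
    assume e: "e > 0"
    \<comment> \<open>An error of at most \<open>\<epsilon> * h\<close> over an interval of length
      \<beta> - \<alpha> integrates to \<open>h * (e / 2)\<close>; dividing by \<open>h\<close>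
      leaves a bound strictly below \<open>e\<close>.\<close>
    define \<epsilon> where "\<epsilon> = e / (2 * (\<beta> - \<alpha>))"
    have \<epsilon>: "\<epsilon> > 0"
      using e less by (simp add: \<epsilon>_def)
    show "\<forall>\<^sub>F h in at_right 0. dist (\<Sum>\<^sub>\<infinity>k. a k * r k h) 0 < e"
      using approx[OF \<epsilon>] eventually_at_right_less[of 0]
    proof eventually_elim
      case (elim h)
      have "norm (h * (\<Sum>\<^sub>\<infinity>k. a k * r k h)) \<le> \<epsilon> * h * measure lborel {\<alpha>..\<beta>}"
        using elim \<epsilon>
        by (intro has_integral_bound_real[OF _ finite.emptyI remainder]) (auto simp: S_def)
      also have "\<dots> = h * (e / 2)"
        using less by (simp add: \<epsilon>_def field_simps)
      finally have "h * \<bar>\<Sum>\<^sub>\<infinity>k. a k * r k h\<bar> \<le> h * (e / 2)"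
        using elim by (simp add: abs_mult)
      then have "\<bar>\<Sum>\<^sub>\<infinity>k. a k * r k h\<bar> \<le> e / 2"
        using elim by (simp only: mult_le_cancel_left_pos)
      then show ?case
        using e by simp
    qed
  qed
  with lim have "q / 2 = 0"
    using tendsto_unique by (metis trivial_limit_at_right_real)
  then show ?thesis
    by (simp add: q_def)
qed

section \<open>From the sampling operator to averages with weights chi(-k)\<close>

lemma unit_step_seq_shift: "unit_step_seq (\<lambda>k. c + of_int k)"
  unfolding unit_step_seq_def
proof (intro conjI allI)
  show "filterlim (\<lambda>k. c + of_int k) at_top at_top"
    by (intro filterlim_tendsto_add_at_top[OF tendsto_const] filterlim_real_of_int_at_top)
  have "\<forall>k \<le> \<lfloor>Z - c\<rfloor>. c + real_of_int k \<le> Z" for Z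
    by (auto simp: le_floor_iff)
  then show "filterlim (\<lambda>k. c + of_int k) at_bot at_bot"
    unfolding filterlim_at_bot eventually_at_bot_linorder by blast
qed simp

theorem theorem3p3:
  fixes chi f :: "real \<Rightarrow> real"
  assumes "sampling_kernel chi"
    and "\<And>u. has_discrete_moment 0 chi u 1"
    and "\<And>u. has_discrete_moment 1 chi u 0"
    and "f \<in> C_ub"
    and "\<forall>\<epsilon>>0. \<exists>w0>0. \<forall>w\<ge>w0. \<forall>t. unit_step_seq t \<longrightarrow>
           ennreal w * sup_norm (\<lambda>x. kantorovich chi t w f x - f x) \<le> ennreal \<epsilon>"
  shows "f constant_on UNIV"
proof -
  define a where "a k = chi (- of_int k)" for k :: int
  have a0: "(a has_sum 1) UNIV"
    using assms(2)[of 0] unfolding has_discrete_moment_def discrete_moment_def has_sum_iff a_def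
    by simp
  \<comment> \<open>At u = 0 the moment factor is -k; since the moment vanishes, the sign can be
    flipped freely.\<close>
  have "((\<lambda>k. a k * (- of_int k)) has_sum 0) UNIV"
    using assms(3)[of 0] unfolding has_discrete_moment_def discrete_moment_def has_sum_iff a_def
    by simp
  from has_sum_uminusI[OF this] have a1: "((\<lambda>k. of_int k * a k) has_sum 0) UNIV"
    by (simp add: mult.commute)
  have f: "continuous_on UNIV f"
    using assms(4) by (auto simp: C_ub_def intro: uniformly_continuous_imp_continuous)
  obtain B where B: "\<And>x. \<bar>f x\<bar> \<le> B"
    using assms(4) by (auto simp: C_ub_def bounded_iff)
  obtain F where F: "\<And>x. (F has_real_derivative f x) (at x)"
    using continuous_real_antiderivative[OF f] by blast
  have F_cell: "integral {u..v} f = F v - F u" if "u \<le> v" for u v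
    using that F
    by (intro integral_unique fundamental_theorem_of_calculus)
       (auto simp flip: has_real_derivative_iff_has_vector_derivative
         intro: has_field_derivative_at_within)
  have approx: "\<forall>\<^sub>F h in at_right 0. \<forall>x.
      \<bar>(\<Sum>\<^sub>\<infinity>k. a k * ((F (x + (of_int k + 1) * h) - F (x + of_int k * h)) / h)) - f x\<bar> \<le> \<epsilon> * h"
    if \<epsilon>: "\<epsilon> > 0" for \<epsilon>
  proof -
    \<comment> \<open>One threshold \<open>w0\<close> serves all node sequences, which is what
      allows the nodes chosen below to vary with both \<open>x\<close> and \<open>w\<close>.\<close>
    obtain w0 where w0: "w0 > 0" "\<And>w t. w \<ge> w0 \<Longrightarrow> unit_step_seq t \<Longrightarrow>
        ennreal w * sup_norm (\<lambda>x. kantorovich chi t w f x - f x) \<le> ennreal \<epsilon>"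
      using assms(5) \<epsilon> by blast
    have "\<forall>\<^sub>F h in at_right 0. h < 1 / w0"
      by (rule eventually_mono[OF eventually_at_right_real[of 0 "1 / w0"]]) (use w0(1) in auto)
    then show ?thesis
      using eventually_at_right_less[of 0]
    proof eventually_elim
      case (elim h)
      define w where "w = 1 / h"
      have w: "w \<ge> w0" "w > 0"
        using elim w0(1) by (auto simp: w_def field_simps)
      show ?case
      proof
        fix x
        \<comment> \<open>Tying the nodes to \<open>x\<close> keeps the kernel arguments \<open>w x - t\<^sub>k = -k\<close> independent of \<open>w\<close> and \<open>x\<close>.\<close>
        define t where "t k = w * x + of_int k" for k :: int
        have t: "unit_step_seq t"
          unfolding t_def by (rule unit_step_seq_shift)
        have node: "t k / w = x + of_int k * h" "t (k + 1) / w = x + (of_int k + 1) * h" for k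
          using elim by (simp_all add: t_def w_def field_simps)
        have le: "x + of_int k * h \<le> x + (of_int k + 1) * h" for k
          using elim by (simp add: distrib_right)
        have "w * integral {t k / w .. t (k + 1) / w} f * chi (w * x - t k) =
            a k * ((F (x + (of_int k + 1) * h) - F (x + of_int k * h)) / h)" for k
          unfolding node(2) node(1)[of k] F_cell[OF le] by (simp add: t_def a_def w_def)
        then have K: "kantorovich chi t w f x =
            (\<Sum>\<^sub>\<infinity>k. a k * ((F (x + (of_int k + 1) * h) - F (x + of_int k * h)) / h))"
          unfolding kantorovich_def by simp
        \<comment> \<open>The sup norm for this particular \<open>t\<close> is used only at the
          point \<open>x\<close> that determined \<open>t\<close>; the finite bound then brings the
          estimate back from \<open>ennreal\<close> to the reals.\<close>
        have "ennreal (w * \<bar>kantorovich chi t w f x - f x\<bar>) =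
            ennreal w * ennreal \<bar>kantorovich chi t w f x - f x\<bar>"
          using w by (simp add: ennreal_mult)
        also have "\<dots> \<le> ennreal w * sup_norm (\<lambda>x. kantorovich chi t w f x - f x)"
          unfolding sup_norm_def by (intro mult_left_mono SUP_upper) auto
        also have "\<dots> \<le> ennreal \<epsilon>"
          by (rule w0(2)[OF w(1) t])
        finally have "w * \<bar>kantorovich chi t w f x - f x\<bar> \<le> \<epsilon>"
          using \<epsilon> by simp
        then show "\<bar>(\<Sum>\<^sub>\<infinity>k. a k * ((F (x + (of_int k + 1) * h) - F (x + of_int k * h)) / h)) - f x\<bar> \<le> \<epsilon> * h"
          unfolding K[symmetric] using elim by (simp add: w_def pos_divide_le_eq)
      qed
    qed
  qed
  have "f \<alpha> = f \<beta>" if "\<alpha> < \<beta>" for \<alpha> \<beta>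
    using saturation_discrete_average[OF a0 a1 F f B approx that] .
  then have "f x = f 0" for x
    by (cases x "0 :: real" rule: linorder_cases) auto
  then show ?thesis
    by (auto simp: constant_on_def)
qed

end
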